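(* Let $J$ be a finite-dimensional unital simple Jordan algebra over $\mathbb{R}$ and let $M=J\otimes E$ be a free module over $J$, with $E$ a finite-dimensional real vector space. Then flat (derivation-based) connections on $M$ are in one-to-one correspondence with Lie algebra homomorphisms $\mathcal{A}:Der(J)\rightarrow End(E)$, the connection corresponding to $\mathcal{A}$ being $\nabla=\nabla^0+\mathcal{A}$, i.e. $\nabla_X(x\otimes e)=X(x)\otimes e+x\otimes\mathcal{A}(X)e$ for $X\in Der(J)$, $x\in J$, $e\in E$. That is, for a basis $\{X_\mu\}\subset Der(J)$ with structure constants $c^\tau_{\mu\nu}$, $[X_\mu,X_\nu]=c^\tau_{\mu\nu}X_\tau$ (summation over repeated indices), one has $$[\mathcal{A}(X_\mu),\mathcal{A}(X_\nu)]=c^\tau_{\mu\nu}\mathcal{A}(X_\tau).$$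
   Context: A (real) Jordan algebra is a real vector space $J$ with a bilinear commutative product satisfying $x(yx^2)=(xy)x^2$ for all $x,y\in J$; a unital Jordan algebra is simple if it is nonzero and its only ideals are $0$ and $J$. With $[x,y,z]=(xy)z-x(yz)$, its center $Z(J)$ is the set of $z\in J$ with $[x,y,z]=[x,z,y]=[z,x,y]=0$ for all $x,y\in J$. $Der(J)$ is the Lie algebra of derivations of $J$, i.e. linear maps $X:J\to J$ with $X(xy)=X(x)y+xX(y)$, under the commutator; it is a $Z(J)$-module by $(zX)(x)=zX(x)$. $End(E)$ is the Lie algebra of linear endomorphisms of $E$ with the commutator. A free $J$-module is $J\otimes E$ (tensor product over $\mathbb{R}$) with action $y(x\otimes e)=(yx)\otimes e$. A derivation-based connection on a $J$-module $M$ is a linear map $\nabla:Der(J)\to End(M)$, $X\mapsto\nabla_X$ (with $End(M)$ the linear endomorphisms of $M$), such that $\nabla_X(xm)=X(x)m+x\nabla_Xm$ and $\nabla_{zX}(m)=z\nabla_X(m)$ for all $X\in Der(J)$, $x\in J$, $m\in M$, $z\in Z(J)$. Its curvature is $R_{X,Y}=[\nabla_X,\nabla_Y]-\nabla_{[X,Y]}$, and $\nabla$ is flat if $R_{X,Y}=0$ for all $X,Y\in Der(J)$. On $M=J\otimes E$ the base connection is $\nabla^0_X(x\otimes e)=X(x)\otimes e$.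
   Formalization: The center is additionally assumed to be Z(J)=R·1; without this the claim fails, e.g. for J=Sym_2(C) regarded over R with E=R, where the sum of the base connection and a real-linear homomorphism A need not be linear over Z(J)=C. *)

theory Defs
  imports "HOL-Analysis.Analysis" "HOL-Analysis.Finite_Function_Topology"
begin

section \<open>Jordan algebras\<close>

class jordan_algebra = real_vector + times +
  assumes jordan_commute: "x * y = y * x"
    and jordan_distrib_right: "(x + y) * z = x * z + y * z"
    and jordan_scaleR_left: "(r *\<^sub>R x) * y = r *\<^sub>R (x * y)"
    and jordan_identity: "x * (y * (x * x)) = (x * y) * (x * x)"

class unital_jordan_algebra = jordan_algebra + one +
  assumes jordan_one_left: "1 * x = x"

lemma (in jordan_algebra) jordan_distrib_left: "z * (x + y) = z * x + z * y"
  using jordan_distrib_right[of x y z] by (simp add: jordan_commute)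

lemma (in jordan_algebra) jordan_scaleR_right: "y * (r *\<^sub>R x) = r *\<^sub>R (y * x)"
  using jordan_scaleR_left[of r x y] by (simp add: jordan_commute)

lemma bilinear_jordan_times: "bilinear ((*) :: 'j::jordan_algebra \<Rightarrow> 'j \<Rightarrow> 'j)"
  unfolding bilinear_def
  by (auto intro!: linearI simp: jordan_distrib_left jordan_distrib_right
      jordan_scaleR_left jordan_scaleR_right)

lemmas jordan_bilinear_simps =
  jordan_distrib_left jordan_distrib_right jordan_scaleR_left jordan_scaleR_right
  bilinear_lzero[OF bilinear_jordan_times] bilinear_rzero[OF bilinear_jordan_times]
  bilinear_lneg[OF bilinear_jordan_times] bilinear_rneg[OF bilinear_jordan_times]
  bilinear_lsub[OF bilinear_jordan_times] bilinear_rsub[OF bilinear_jordan_times]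

definition jordan_ideal :: "'j::jordan_algebra set \<Rightarrow> bool" where
  "jordan_ideal I \<longleftrightarrow> subspace I \<and> (\<forall>x\<in>I. \<forall>y. y * x \<in> I)"

definition simple_jordan :: "'j::unital_jordan_algebra itself \<Rightarrow> bool" where
  "simple_jordan TYPE('j) \<longleftrightarrow>
     (\<exists>x::'j. x \<noteq> 0) \<and> (\<forall>I::'j set. jordan_ideal I \<longrightarrow> I = {0} \<or> I = UNIV)"

definition associator :: "'j::jordan_algebra \<Rightarrow> 'j \<Rightarrow> 'j \<Rightarrow> 'j" where
  "associator x y z = (x * y) * z - x * (y * z)"

definition jordan_center :: "'j::jordan_algebra set" where
  "jordan_center =
     {z. \<forall>x y. associator x y z = 0 \<and> associator x z y = 0 \<and> associator z x y = 0}"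

text \<open>The center of a finite-dimensional simple unital algebra is a field extension of the reals,
  hence either \<open>range (\<lambda>r. r *\<^sub>R 1)\<close> or a copy of the complex numbers; in the second case
  the algebra is a complex Jordan algebra regarded over the reals. The condition that connections
  be linear over the center distinguishes the two cases.\<close>

definition finite_dim :: "'a::real_vector itself \<Rightarrow> bool" where
  "finite_dim TYPE('a) \<longleftrightarrow> (\<exists>B::'a set. finite B \<and> span B = UNIV)"


section \<open>Lie algebras\<close>

class lie_algebra = real_vector +
  fixes lie_bracket :: "'a \<Rightarrow> 'a \<Rightarrow> 'a"
  assumes lie_add_left: "lie_bracket (x + y) z = lie_bracket x z + lie_bracket y z"
    and lie_scaleR_left: "lie_bracket (r *\<^sub>R x) y = r *\<^sub>R lie_bracket x y"
    and lie_add_right: "lie_bracket z (x + y) = lie_bracket z x + lie_bracket z y"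
    and lie_scaleR_right: "lie_bracket y (r *\<^sub>R x) = r *\<^sub>R lie_bracket y x"
    and lie_self: "lie_bracket x x = 0"
    and lie_jacobi: "lie_bracket x (lie_bracket y z) + lie_bracket y (lie_bracket z x)
          + lie_bracket z (lie_bracket x y) = 0"

definition lie_hom :: "('a::lie_algebra \<Rightarrow> 'b::lie_algebra) \<Rightarrow> bool" where
  "lie_hom A \<longleftrightarrow> linear A \<and> (\<forall>X Y. A (lie_bracket X Y) = lie_bracket (A X) (A Y))"


subsection \<open>The Lie algebra of linear endomorphisms\<close>

typedef (overloaded) 'a endo = "{f :: 'a::real_vector \<Rightarrow> 'a. linear f}"
  morphisms endo_app Endo
  by (auto intro: linear_zero)

setup_lifting type_definition_endo

lemma linear_endo_app: "linear (endo_app f)"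
  by transfer

lemmas endo_app_simps =
  linear_add[OF linear_endo_app] linear_diff[OF linear_endo_app] linear_neg[OF linear_endo_app]
  linear_0[OF linear_endo_app] linear_scale[OF linear_endo_app]

lemma endo_eqI: "(\<And>x. endo_app f x = endo_app g x) \<Longrightarrow> f = g"
  by transfer auto

instantiation endo :: (real_vector) lie_algebra
begin

lift_definition zero_endo :: "'a endo" is "\<lambda>_. 0" by (rule linear_zero)
lift_definition plus_endo :: "'a endo \<Rightarrow> 'a endo \<Rightarrow> 'a endo" is "\<lambda>f g x. f x + g x"
  by (rule linear_compose_add)
lift_definition minus_endo :: "'a endo \<Rightarrow> 'a endo \<Rightarrow> 'a endo" is "\<lambda>f g x. f x - g x"
  by (rule linear_compose_sub)
lift_definition uminus_endo :: "'a endo \<Rightarrow> 'a endo" is "\<lambda>f x. - f x"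
  by (rule linear_compose_neg)
lift_definition scaleR_endo :: "real \<Rightarrow> 'a endo \<Rightarrow> 'a endo" is "\<lambda>r f x. r *\<^sub>R f x"
  by (rule linear_compose_scale_right)
lift_definition lie_bracket_endo :: "'a endo \<Rightarrow> 'a endo \<Rightarrow> 'a endo"
  is "\<lambda>f g x. f (g x) - g (f x)"
  by (auto intro!: linearI simp: linear_add linear_scale scaleR_diff_right)

instance
proof
  fix f g h :: "'a endo" and r s :: real
  show "f + g + h = f + (g + h)" by transfer (simp add: add.assoc)
  show "f + g = g + f" by transfer (simp add: add.commute)
  show "0 + f = f" by transfer simp
  show "- f + f = 0" by transfer simp
  show "f - g = f + - g" by transfer simp
  show "r *\<^sub>R (f + g) = r *\<^sub>R f + r *\<^sub>R g" by transfer (simp add: scaleR_add_right)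
  show "(r + s) *\<^sub>R f = r *\<^sub>R f + s *\<^sub>R f" by transfer (simp add: scaleR_add_left)
  show "r *\<^sub>R s *\<^sub>R f = (r * s) *\<^sub>R f" by transfer simp
  show "1 *\<^sub>R f = f" by transfer simp
  show "lie_bracket (f + g) h = lie_bracket f h + lie_bracket g h"
    by transfer (simp add: linear_add fun_eq_iff)
  show "lie_bracket (r *\<^sub>R f) g = r *\<^sub>R lie_bracket f g"
    by transfer (simp add: linear_scale scaleR_diff_right fun_eq_iff)
  show "lie_bracket h (f + g) = lie_bracket h f + lie_bracket h g"
    by transfer (simp add: linear_add fun_eq_iff)
  show "lie_bracket g (r *\<^sub>R f) = r *\<^sub>R lie_bracket g f"
    by transfer (simp add: linear_scale scaleR_diff_right fun_eq_iff)
  show "lie_bracket f f = 0" by transfer simp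
  show "lie_bracket f (lie_bracket g h) + lie_bracket g (lie_bracket h f)
      + lie_bracket h (lie_bracket f g) = 0"
    by transfer (simp add: linear_diff fun_eq_iff)
qed

end

lemma endo_app_ops [simp]:
  "endo_app 0 x = 0"
  "endo_app (f + g) x = endo_app f x + endo_app g x"
  "endo_app (f - g) x = endo_app f x - endo_app g x"
  "endo_app (- f) x = - endo_app f x"
  "endo_app (r *\<^sub>R f) x = r *\<^sub>R endo_app f x"
  "endo_app (lie_bracket f g) x = endo_app f (endo_app g x) - endo_app g (endo_app f x)"
  by (transfer, simp)+


subsection \<open>The Lie algebra of derivations\<close>

typedef (overloaded) 'j der =
  "{X :: 'j::jordan_algebra \<Rightarrow> 'j. linear X \<and> (\<forall>x y. X (x * y) = X x * y + x * X y)}"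
  morphisms der_app Der
  by (rule exI[of _ "\<lambda>_. 0"]) (auto intro: linear_zero simp: jordan_bilinear_simps)

setup_lifting type_definition_der

lemma linear_der_app: "linear (der_app X)"
  by transfer simp

lemma der_app_times: "der_app X (x * y) = der_app X x * y + x * der_app X y"
  by transfer simp

lemmas der_app_simps =
  linear_add[OF linear_der_app] linear_diff[OF linear_der_app] linear_neg[OF linear_der_app]
  linear_0[OF linear_der_app] linear_scale[OF linear_der_app]

lemma der_eqI: "(\<And>x. der_app X x = der_app Y x) \<Longrightarrow> X = Y"
  by transfer auto

instantiation der :: (jordan_algebra) lie_algebra
begin

lift_definition zero_der :: "'a der" is "\<lambda>_. 0"
  by (auto intro: linear_zero simp: jordan_bilinear_simps)
lift_definition plus_der :: "'a der \<Rightarrow> 'a der \<Rightarrow> 'a der" is "\<lambda>X Y x. X x + Y x"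
  by (auto intro: linear_compose_add simp: jordan_bilinear_simps)
lift_definition minus_der :: "'a der \<Rightarrow> 'a der \<Rightarrow> 'a der" is "\<lambda>X Y x. X x - Y x"
  by (auto intro: linear_compose_sub simp: jordan_bilinear_simps)
lift_definition uminus_der :: "'a der \<Rightarrow> 'a der" is "\<lambda>X x. - X x"
  by (auto intro: linear_compose_neg simp: jordan_bilinear_simps)
lift_definition scaleR_der :: "real \<Rightarrow> 'a der \<Rightarrow> 'a der" is "\<lambda>r X x. r *\<^sub>R X x"
  by (auto intro: linear_compose_scale_right simp: jordan_bilinear_simps scaleR_add_right)
lift_definition lie_bracket_der :: "'a der \<Rightarrow> 'a der \<Rightarrow> 'a der"
  is "\<lambda>X Y x. X (Y x) - Y (X x)"
  by (auto intro!: linearI simp: linear_add linear_scale scaleR_diff_right jordan_bilinear_simps)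

instance
proof
  fix f g h :: "'a der" and r s :: real
  show "f + g + h = f + (g + h)" by transfer (simp add: add.assoc)
  show "f + g = g + f" by transfer (simp add: add.commute)
  show "0 + f = f" by transfer simp
  show "- f + f = 0" by transfer simp
  show "f - g = f + - g" by transfer simp
  show "r *\<^sub>R (f + g) = r *\<^sub>R f + r *\<^sub>R g" by transfer (simp add: scaleR_add_right)
  show "(r + s) *\<^sub>R f = r *\<^sub>R f + s *\<^sub>R f" by transfer (simp add: scaleR_add_left)
  show "r *\<^sub>R s *\<^sub>R f = (r * s) *\<^sub>R f" by transfer simp
  show "1 *\<^sub>R f = f" by transfer simp
  show "lie_bracket (f + g) h = lie_bracket f h + lie_bracket g h"
    by transfer (simp add: linear_add fun_eq_iff)
  show "lie_bracket (r *\<^sub>R f) g = r *\<^sub>R lie_bracket f g"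
    by transfer (simp add: linear_scale scaleR_diff_right fun_eq_iff)
  show "lie_bracket h (f + g) = lie_bracket h f + lie_bracket h g"
    by transfer (simp add: linear_add fun_eq_iff)
  show "lie_bracket g (r *\<^sub>R f) = r *\<^sub>R lie_bracket g f"
    by transfer (simp add: linear_scale scaleR_diff_right fun_eq_iff)
  show "lie_bracket f f = 0" by transfer simp
  show "lie_bracket f (lie_bracket g h) + lie_bracket g (lie_bracket h f)
      + lie_bracket h (lie_bracket f g) = 0"
    by transfer (simp add: linear_diff fun_eq_iff)
qed

end

lemma der_app_ops [simp]:
  "der_app 0 x = 0"
  "der_app (X + Y) x = der_app X x + der_app Y x"
  "der_app (X - Y) x = der_app X x - der_app Y x"
  "der_app (- X) x = - der_app X x"
  "der_app (r *\<^sub>R X) x = r *\<^sub>R der_app X x"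
  "der_app (lie_bracket X Y) x = der_app X (der_app Y x) - der_app Y (der_app X x)"
  by (transfer, simp)+

text \<open>The center acts on derivations pointwise. For \<open>z\<close> outside the center the map
  \<open>x \<mapsto> z * X x\<close> need not be a derivation; the operation is totalised by \<open>0\<close> there,
  and it is only used for \<open>z\<close> in the center.\<close>

lift_definition center_scale :: "'j::jordan_algebra \<Rightarrow> 'j der \<Rightarrow> 'j der"
  is "\<lambda>z X x. if z \<in> jordan_center then z * X x else 0"
proof -
  fix z :: 'j and X :: "'j \<Rightarrow> 'j"
  assume X: "linear X \<and> (\<forall>x y. X (x * y) = X x * y + x * X y)"
  show "linear (\<lambda>x. if z \<in> jordan_center then z * X x else 0) \<and>
    (\<forall>x y. (if z \<in> jordan_center then z * X (x * y) else 0) =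
       (if z \<in> jordan_center then z * X x else 0) * y +
       x * (if z \<in> jordan_center then z * X y else 0))"
  proof (cases "z \<in> jordan_center")
    case True
    have 1: "(z * a) * b = z * (a * b)" and 2: "(a * z) * b = a * (z * b)" for a b
      using True by (auto simp: jordan_center_def associator_def)
    have "z * (X x * y + x * X y) = (z * X x) * y + x * (z * X y)" for x y
      using 1[of "X x" y] 1[of x "X y"] 2[of x "X y"] jordan_commute[of x z]
      by (simp add: jordan_distrib_left)
    with X True show ?thesis
      by (auto intro!: linearI simp: linear_add linear_scale jordan_bilinear_simps)
  qed (auto intro: linear_zero simp: jordan_bilinear_simps)
qed

lemma der_app_center_scale: "z \<in> jordan_center \<Longrightarrow> der_app (center_scale z X) x = z * der_app X x"
  by transfer simp


section \<open>Tensor products of real vector spaces\<close>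

text \<open>The tensor product is the free real vector space on \<open>'a \<times> 'b\<close>, realised by finitely
  supported functions, modulo the bilinearity relations.\<close>

inductive_set tensor_generators :: "('a::real_vector \<times> 'b::real_vector \<Rightarrow>\<^sub>0 real) set" where
  add_left: "Poly_Mapping.single (x + y, e) 1
     - (Poly_Mapping.single (x, e) 1 + Poly_Mapping.single (y, e) 1) \<in> tensor_generators"
| add_right: "Poly_Mapping.single (x, e + f) 1
     - (Poly_Mapping.single (x, e) 1 + Poly_Mapping.single (x, f) 1) \<in> tensor_generators"
| scaleR_left: "Poly_Mapping.single (r *\<^sub>R x, e) 1 - r *\<^sub>R Poly_Mapping.single (x, e) 1
     \<in> tensor_generators"
| scaleR_right: "Poly_Mapping.single (x, r *\<^sub>R e) 1 - r *\<^sub>R Poly_Mapping.single (x, e) 1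
     \<in> tensor_generators"

definition tensor_relations :: "('a::real_vector \<times> 'b::real_vector \<Rightarrow>\<^sub>0 real) set" where
  "tensor_relations = span tensor_generators"

lemma subspace_tensor_relations: "subspace tensor_relations"
  unfolding tensor_relations_def by (rule subspace_span)

lemma equivp_tensor_relations: "equivp (\<lambda>p q. p - q \<in> tensor_relations)"
proof (rule equivpI)
  note S = subspace_tensor_relations
  show "reflp (\<lambda>p q. p - q \<in> tensor_relations)"
    by (rule reflpI) (simp add: subspace_0[OF S])
  show "symp (\<lambda>p q. p - q \<in> tensor_relations)"
    using subspace_neg[OF S] by (intro sympI) fastforce
  show "transp (\<lambda>p q. p - q \<in> tensor_relations)"
    using subspace_add[OF S] by (intro transpI) fastforce
qed

quotient_type (overloaded) ('a, 'b) tensor =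
  "'a::real_vector \<times> 'b::real_vector \<Rightarrow>\<^sub>0 real" / "\<lambda>p q. p - q \<in> tensor_relations"
  by (rule equivp_tensor_relations)

instantiation tensor :: (real_vector, real_vector) real_vector
begin

lift_definition zero_tensor :: "('a, 'b) tensor" is 0 .
lift_definition plus_tensor :: "('a, 'b) tensor \<Rightarrow> ('a, 'b) tensor \<Rightarrow> ('a, 'b) tensor" is "(+)"
proof -
  fix p q p' q' :: "'a \<times> 'b \<Rightarrow>\<^sub>0 real"
  assume "p - q \<in> tensor_relations" "p' - q' \<in> tensor_relations"
  then have "(p - q) + (p' - q') \<in> tensor_relations"
    by (rule subspace_add[OF subspace_tensor_relations])
  then show "p + p' - (q + q') \<in> tensor_relations" by (simp add: algebra_simps)
qed
lift_definition minus_tensor :: "('a, 'b) tensor \<Rightarrow> ('a, 'b) tensor \<Rightarrow> ('a, 'b) tensor" is "(-)"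
proof -
  fix p q p' q' :: "'a \<times> 'b \<Rightarrow>\<^sub>0 real"
  assume "p - q \<in> tensor_relations" "p' - q' \<in> tensor_relations"
  then have "(p - q) - (p' - q') \<in> tensor_relations"
    by (rule subspace_diff[OF subspace_tensor_relations])
  then show "p - p' - (q - q') \<in> tensor_relations" by (simp add: algebra_simps)
qed
lift_definition uminus_tensor :: "('a, 'b) tensor \<Rightarrow> ('a, 'b) tensor" is uminus
proof -
  fix p q :: "'a \<times> 'b \<Rightarrow>\<^sub>0 real"
  assume "p - q \<in> tensor_relations"
  then have "- (p - q) \<in> tensor_relations"
    by (rule subspace_neg[OF subspace_tensor_relations])
  then show "- p - - q \<in> tensor_relations" by simp
qed
lift_definition scaleR_tensor :: "real \<Rightarrow> ('a, 'b) tensor \<Rightarrow> ('a, 'b) tensor" is scaleR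
proof -
  fix r :: real and p q :: "'a \<times> 'b \<Rightarrow>\<^sub>0 real"
  assume "p - q \<in> tensor_relations"
  then have "r *\<^sub>R (p - q) \<in> tensor_relations"
    by (rule subspace_scale[OF subspace_tensor_relations])
  then show "r *\<^sub>R p - r *\<^sub>R q \<in> tensor_relations" by (simp add: scaleR_diff_right)
qed

instance
proof
  note [simp] = subspace_0[OF subspace_tensor_relations]
  fix a b c :: "('a, 'b) tensor" and r s :: real
  show "a + b + c = a + (b + c)" by transfer (simp add: add.assoc)
  show "a + b = b + a" by transfer (simp add: add.commute)
  show "0 + a = a" by transfer simp
  show "- a + a = 0" by transfer simp
  show "a - b = a + - b" by transfer simp
  show "r *\<^sub>R (a + b) = r *\<^sub>R a + r *\<^sub>R b" by transfer (simp add: scaleR_add_right)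
  show "(r + s) *\<^sub>R a = r *\<^sub>R a + s *\<^sub>R a" by transfer (simp add: scaleR_add_left)
  show "r *\<^sub>R s *\<^sub>R a = (r * s) *\<^sub>R a" by transfer simp
  show "1 *\<^sub>R a = a" by transfer simp
qed

end

definition pure_tensor :: "'a::real_vector \<Rightarrow> 'b::real_vector \<Rightarrow> ('a, 'b) tensor"
    (infixl "\<otimes>\<^sub>t" 72)
  where "x \<otimes>\<^sub>t e = abs_tensor (Poly_Mapping.single (x, e) 1)"

lemma bilinear_pure_tensor: "bilinear (\<otimes>\<^sub>t)"
proof -
  note I = tensor_generators.intros[THEN span_base, folded tensor_relations_def]
  note ops = pure_tensor_def plus_tensor.abs_eq scaleR_tensor.abs_eq tensor.abs_eq_iff
  have 1: "(x + y) \<otimes>\<^sub>t e = x \<otimes>\<^sub>t e + y \<otimes>\<^sub>t e" for x y :: 'a and e :: 'b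
    unfolding ops by (rule I(1))
  have 2: "x \<otimes>\<^sub>t (e + f) = x \<otimes>\<^sub>t e + x \<otimes>\<^sub>t f" for x :: 'a and e f :: 'b
    unfolding ops by (rule I(2))
  have 3: "(r *\<^sub>R x) \<otimes>\<^sub>t e = r *\<^sub>R (x \<otimes>\<^sub>t e)" for r and x :: 'a and e :: 'b
    unfolding ops by (rule I(3))
  have 4: "x \<otimes>\<^sub>t (r *\<^sub>R e) = r *\<^sub>R (x \<otimes>\<^sub>t e)" for r and x :: 'a and e :: 'b
    unfolding ops by (rule I(4))
  show ?thesis
    unfolding bilinear_def by (intro conjI allI linearI 1 2 3 4)
qed

text \<open>\<open>tensor_lift b\<close> is the linear map induced by a bilinear map \<open>b\<close>; the lemmas below
  establish the universal property of the tensor product.\<close>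

definition free_lift :: "('a \<Rightarrow> 'b \<Rightarrow> 'c::real_vector) \<Rightarrow> ('a \<times> 'b \<Rightarrow>\<^sub>0 real) \<Rightarrow> 'c" where
  "free_lift b p =
     (\<Sum>(x, e)\<in>Poly_Mapping.keys p. Poly_Mapping.lookup p (x, e) *\<^sub>R b x e)"

definition tensor_lift ::
    "('a::real_vector \<Rightarrow> 'b::real_vector \<Rightarrow> 'c::real_vector) \<Rightarrow> ('a, 'b) tensor \<Rightarrow> 'c" where
  "tensor_lift b t = free_lift b (rep_tensor t)"

lemma lookup_scaleR_poly_mapping:
  "Poly_Mapping.lookup (r *\<^sub>R p) x = r *\<^sub>R Poly_Mapping.lookup p x"
proof -
  have "finite {i. r *\<^sub>R Poly_Mapping.lookup p i \<noteq> 0}"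
    by (rule finite_subset[OF _ finite_lookup[of p]]) auto
  then show ?thesis
    by (simp add: scaleR_poly_mapping_def)
qed

lemma free_lift_superset:
  assumes "finite S" "Poly_Mapping.keys p \<subseteq> S"
  shows "free_lift b p = (\<Sum>(x, e)\<in>S. Poly_Mapping.lookup p (x, e) *\<^sub>R b x e)"
  unfolding free_lift_def
  by (rule sum.mono_neutral_left) (use assms in \<open>auto simp: in_keys_iff\<close>)

lemma linear_free_lift: "linear (free_lift b)"
proof (rule linearI)
  fix p q :: "'a \<times> 'b \<Rightarrow>\<^sub>0 real" and r :: real
  let ?S = "Poly_Mapping.keys p \<union> Poly_Mapping.keys q"
  have "free_lift b p = (\<Sum>(x, e)\<in>?S. Poly_Mapping.lookup p (x, e) *\<^sub>R b x e)"
    "free_lift b q = (\<Sum>(x, e)\<in>?S. Poly_Mapping.lookup q (x, e) *\<^sub>R b x e)"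
    "free_lift b (p + q) = (\<Sum>(x, e)\<in>?S. Poly_Mapping.lookup (p + q) (x, e) *\<^sub>R b x e)"
    using Poly_Mapping.keys_add[of p q] by (intro free_lift_superset; auto)+
  then show "free_lift b (p + q) = free_lift b p + free_lift b q"
    by (simp add: lookup_add scaleR_add_left sum.distrib case_prod_beta)
  have "free_lift b (r *\<^sub>R p) =
      (\<Sum>(x, e)\<in>Poly_Mapping.keys p. Poly_Mapping.lookup (r *\<^sub>R p) (x, e) *\<^sub>R b x e)"
    by (rule free_lift_superset) (auto simp: in_keys_iff lookup_scaleR_poly_mapping)
  then show "free_lift b (r *\<^sub>R p) = r *\<^sub>R free_lift b p"
    by (simp add: free_lift_def lookup_scaleR_poly_mapping scaleR_sum_right case_prod_beta)
qed

lemma free_lift_single: "free_lift b (Poly_Mapping.single (x, e) 1) = b x e"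
  by (simp add: free_lift_def)

lemma free_lift_relations:
  fixes b :: "'a::real_vector \<Rightarrow> 'b::real_vector \<Rightarrow> 'c::real_vector"
  assumes b: "bilinear b" and p: "p \<in> tensor_relations"
  shows "free_lift b p = 0"
  using p unfolding tensor_relations_def
proof (rule span_induct)
  show "subspace {p. free_lift b p = 0}"
    by (rule linear_subspace_kernel[OF linear_free_lift])
  fix q :: "'a \<times> 'b \<Rightarrow>\<^sub>0 real"
  assume "q \<in> tensor_generators"
  then show "free_lift b q = 0"
    by cases (simp_all add: linear_diff[OF linear_free_lift] linear_add[OF linear_free_lift]
        linear_scale[OF linear_free_lift] free_lift_single
        bilinear_ladd[OF b] bilinear_radd[OF b] bilinear_lmul[OF b] bilinear_rmul[OF b])
qed

lemma tensor_lift_abs: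
  assumes "bilinear b"
  shows "tensor_lift b (abs_tensor p) = free_lift b p"
proof -
  have "rep_tensor (abs_tensor p) - p \<in> tensor_relations"
    by (rule rep_abs_rsp_left[OF Quotient3_tensor])
      (simp add: subspace_0[OF subspace_tensor_relations])
  then show ?thesis
    using free_lift_relations[OF assms, of "rep_tensor (abs_tensor p) - p"]
    by (simp add: tensor_lift_def linear_diff[OF linear_free_lift])
qed

lemma linear_tensor_lift:
  assumes "bilinear b"
  shows "linear (tensor_lift b)"
proof (rule linearI)
  fix s t :: "('a, 'b) tensor" and r :: real
  obtain p q where st: "s = abs_tensor p" "t = abs_tensor q"
    using Quotient3_abs_rep[OF Quotient3_tensor] by metis
  have "s + t = abs_tensor (p + q)" "r *\<^sub>R s = abs_tensor (r *\<^sub>R p)"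
    by (simp_all add: st plus_tensor.abs_eq scaleR_tensor.abs_eq)
  then show "tensor_lift b (s + t) = tensor_lift b s + tensor_lift b t"
    "tensor_lift b (r *\<^sub>R s) = r *\<^sub>R tensor_lift b s"
    using linear_free_lift[of b]
    by (simp_all add: st tensor_lift_abs[OF assms] linear_add linear_scale)
qed

lemma tensor_lift_pure:
  assumes "bilinear b"
  shows "tensor_lift b (x \<otimes>\<^sub>t e) = b x e"
  by (simp add: pure_tensor_def tensor_lift_abs[OF assms] free_lift_single)

lemma poly_mapping_eq_sum_singles:
  "p = (\<Sum>k\<in>Poly_Mapping.keys p. Poly_Mapping.lookup p k *\<^sub>R Poly_Mapping.single k (1::real))"
  by (rule poly_mapping_eqI)
    (simp add: lookup_sum lookup_scaleR_poly_mapping lookup_single when_def if_distrib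
      in_keys_iff cong: if_cong)

lemma span_pure_tensors: "span (range (\<lambda>(x, e). x \<otimes>\<^sub>t e)) = UNIV"
proof -
  have lin: "linear abs_tensor"
    by (rule linearI) (simp_all add: plus_tensor.abs_eq scaleR_tensor.abs_eq)
  have "abs_tensor p \<in> span (range (\<lambda>(x, e). x \<otimes>\<^sub>t e))" for p :: "'a \<times> 'b \<Rightarrow>\<^sub>0 real"
  proof -
    have "abs_tensor (Poly_Mapping.single k 1) = fst k \<otimes>\<^sub>t snd k" for k :: "'a \<times> 'b"
      by (simp add: pure_tensor_def)
    then have "abs_tensor p =
        (\<Sum>k\<in>Poly_Mapping.keys p. Poly_Mapping.lookup p k *\<^sub>R (fst k \<otimes>\<^sub>t snd k))"
      by (subst poly_mapping_eq_sum_singles) (simp add: linear_sum[OF lin] linear_scale[OF lin])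
    also have "\<dots> \<in> span (range (\<lambda>(x, e). x \<otimes>\<^sub>t e))"
      by (intro span_sum span_scale span_base) (auto simp: image_def)
    finally show ?thesis .
  qed
  then have "t \<in> span (range (\<lambda>(x, e). x \<otimes>\<^sub>t e))" for t :: "('a, 'b) tensor"
    using Quotient3_abs_rep[OF Quotient3_tensor, of t] by metis
  then show ?thesis by blast
qed

lemma tensor_linear_eqI:
  fixes f g :: "('a::real_vector, 'b::real_vector) tensor \<Rightarrow> 'c::real_vector"
  assumes "linear f" "linear g" "\<And>x e. f (x \<otimes>\<^sub>t e) = g (x \<otimes>\<^sub>t e)"
  shows "f = g"
proof
  fix t :: "('a, 'b) tensor"
  have "t \<in> span (range (\<lambda>(x, e). x \<otimes>\<^sub>t e))"
    by (simp add: span_pure_tensors)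
  then show "f t = g t"
    by (rule linear_eq_on[OF assms(1,2)]) (use assms(3) in auto)
qed

definition tensor_map :: "('a::real_vector \<Rightarrow> 'c::real_vector) \<Rightarrow> ('b::real_vector \<Rightarrow> 'd::real_vector)
    \<Rightarrow> ('a, 'b) tensor \<Rightarrow> ('c, 'd) tensor" where
  "tensor_map f g = tensor_lift (\<lambda>x e. f x \<otimes>\<^sub>t g e)"

lemma
  assumes "linear f" "linear g"
  shows linear_tensor_map: "linear (tensor_map f g)"
    and tensor_map_pure: "tensor_map f g (x \<otimes>\<^sub>t e) = f x \<otimes>\<^sub>t g e"
proof -
  have "bilinear (\<lambda>x e. f x \<otimes>\<^sub>t g e)"
    using assms unfolding bilinear_def
    by (auto intro!: linearI simp: linear_add linear_scale
        bilinear_ladd[OF bilinear_pure_tensor] bilinear_radd[OF bilinear_pure_tensor]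
        bilinear_lmul[OF bilinear_pure_tensor] bilinear_rmul[OF bilinear_pure_tensor])
  then show "linear (tensor_map f g)" "tensor_map f g (x \<otimes>\<^sub>t e) = f x \<otimes>\<^sub>t g e"
    unfolding tensor_map_def by (simp_all add: linear_tensor_lift tensor_lift_pure)
qed


section \<open>Free modules and derivation-based connections\<close>

definition free_action ::
    "'j::jordan_algebra \<Rightarrow> ('j, 'e::real_vector) tensor \<Rightarrow> ('j, 'e) tensor" where
  "free_action y = tensor_map (\<lambda>x. y * x) (\<lambda>e. e)"

lemma linear_jordan_times: "linear (\<lambda>x. y * x)" for y :: "'j::jordan_algebra"
  using bilinear_jordan_times unfolding bilinear_def by blast

lemma free_action_pure: "free_action y (x \<otimes>\<^sub>t e) = (y * x) \<otimes>\<^sub>t e"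
  unfolding free_action_def by (rule tensor_map_pure) (auto intro: linear_jordan_times linear_ident)

text \<open>Connections are defined for an arbitrary action \<open>act\<close> of \<open>'j\<close> on a vector space \<open>'m\<close>.\<close>

definition connection ::
    "('j::jordan_algebra \<Rightarrow> 'm \<Rightarrow> 'm) \<Rightarrow> ('j der \<Rightarrow> 'm::real_vector endo) \<Rightarrow> bool" where
  "connection act D \<longleftrightarrow> linear D \<and>
     (\<forall>X x m. endo_app (D X) (act x m) = act (der_app X x) m + act x (endo_app (D X) m)) \<and>
     (\<forall>z\<in>jordan_center. \<forall>X m. endo_app (D (center_scale z X)) m = act z (endo_app (D X) m))"

definition curvature ::
    "('j::jordan_algebra der \<Rightarrow> 'm::real_vector endo) \<Rightarrow> 'j der \<Rightarrow> 'j der \<Rightarrow> 'm endo" where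
  "curvature D X Y = lie_bracket (D X) (D Y) - D (lie_bracket X Y)"

definition flat :: "('j::jordan_algebra der \<Rightarrow> 'm::real_vector endo) \<Rightarrow> bool" where
  "flat D \<longleftrightarrow> (\<forall>X Y. curvature D X Y = 0)"

lift_definition base_connection ::
    "'j::jordan_algebra der \<Rightarrow> ('j, 'e::real_vector) tensor endo"
  is "\<lambda>X. tensor_map (der_app X) (\<lambda>e. e)"
  by (rule linear_tensor_map[OF linear_der_app linear_ident])

lift_definition id_tensor :: "'e::real_vector endo \<Rightarrow> ('j::jordan_algebra, 'e) tensor endo"
  is "\<lambda>f. tensor_map (\<lambda>x. x) f"
  by (rule linear_tensor_map[OF linear_ident])

definition connection_of ::
    "('j::jordan_algebra der \<Rightarrow> 'e::real_vector endo) \<Rightarrow> 'j der \<Rightarrow> ('j, 'e) tensor endo" where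
  "connection_of A X = base_connection X + id_tensor (A X)"

end

theory Submission
  imports Defs
begin

text \<open>Two connections on the same module differ by a map \<open>B\<close> on derivations whose values are linear
  over \<open>J\<close>, because the Leibniz terms cancel. The point of the theorem is therefore to determine
  the endomorphisms \<open>F\<close> of \<open>J \<otimes> E\<close> that commute with the action of \<open>J\<close>, and these
  are only the obvious ones, \<open>id \<otimes> f\<close> with \<open>f\<close> an endomorphism of \<open>E\<close>
  (\<open>action_commuting_endo\<close>). The reason is non-associativity: the operator \<open>y (x \<cdot>)\<close>
  on \<open>J \<otimes> E\<close> differs in general from \<open>(y x) \<cdot>\<close>, but the two agree on \<open>1 \<otimes> e\<close>, hence on its image
  \<open>F (1 \<otimes> e)\<close>. Expanded along a basis of \<open>E\<close>, this image has coefficients \<open>z\<close> in \<open>J\<close> with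
  \<open>y (x z) = (y x) z\<close> for all \<open>x\<close> and \<open>y\<close>. By commutativity one vanishing associator
  forces the other two to vanish, so each \<open>z\<close> is central (\<open>associates_imp_center\<close>), and
  the center consists of the real multiples of \<open>1\<close>. Hence \<open>F (1 \<otimes> e) = 1 \<otimes> f e\<close>, and since \<open>1 \<otimes> e\<close> generates
  the module, \<open>F = id \<otimes> f\<close>.

  So every connection is \<open>\<nabla>\<^sup>0 + id \<otimes> A\<close> with \<open>A\<close> linear. The base connection is flat and acts on
  the other tensor factor, so the mixed commutators vanish and the curvature is
  \<open>id \<otimes> ([A X, A Y] - A [X, Y])\<close> (\<open>curvature_connection_of\<close>). As \<open>f \<mapsto> id \<otimes> f\<close> is injective for
  \<open>J \<noteq> 0\<close>, flatness says exactly that \<open>A\<close> is a homomorphism of Lie algebras. A bilinear identity may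
  be tested on a basis, which gives the form with structure constants.\<close>

section \<open>Maps on pure tensors\<close>

lemmas pure_tensor_simps =
  bilinear_ladd[OF bilinear_pure_tensor] bilinear_radd[OF bilinear_pure_tensor]
  bilinear_lmul[OF bilinear_pure_tensor] bilinear_rmul[OF bilinear_pure_tensor]
  bilinear_lzero[OF bilinear_pure_tensor] bilinear_rzero[OF bilinear_pure_tensor]
  bilinear_lsub[OF bilinear_pure_tensor] bilinear_rsub[OF bilinear_pure_tensor]

lemma linear_free_action: "linear (free_action y)"
  unfolding free_action_def by (intro linear_tensor_map linear_jordan_times linear_ident)

lemma linear_pure_right: "linear (\<lambda>e. x \<otimes>\<^sub>t e)"
  by (intro linearI) (simp_all add: pure_tensor_simps)

lemma base_connection_pure: "endo_app (base_connection X) (x \<otimes>\<^sub>t e) = der_app X x \<otimes>\<^sub>t e"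
  by transfer (simp add: tensor_map_pure linear_der_app linear_ident)

lemma id_tensor_pure: "endo_app (id_tensor f) (x \<otimes>\<^sub>t e) = x \<otimes>\<^sub>t endo_app f e"
  by transfer (simp add: tensor_map_pure linear_ident)

lemma connection_of_pure:
  "endo_app (connection_of A X) (x \<otimes>\<^sub>t e) = der_app X x \<otimes>\<^sub>t e + x \<otimes>\<^sub>t endo_app (A X) e"
  by (simp add: connection_of_def base_connection_pure id_tensor_pure)

lemma endo_tensor_eqI:
  fixes F G :: "('a::real_vector, 'b::real_vector) tensor endo"
  assumes "\<And>x e. endo_app F (x \<otimes>\<^sub>t e) = endo_app G (x \<otimes>\<^sub>t e)"
  shows "F = G"
  using tensor_linear_eqI[OF linear_endo_app linear_endo_app assms]
  by (auto intro: endo_eqI)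

lemma linear_id_tensor: "linear id_tensor"
  by (intro linearI endo_tensor_eqI) (simp_all add: id_tensor_pure pure_tensor_simps)

lemma linear_base_connection: "linear base_connection"
  by (intro linearI endo_tensor_eqI) (simp_all add: base_connection_pure pure_tensor_simps)

section \<open>Contractions of a tensor product\<close>

definition contract_left ::
    "('a::real_vector \<Rightarrow> real) \<Rightarrow> ('a, 'b::real_vector) tensor \<Rightarrow> 'b" where
  "contract_left l = tensor_lift (\<lambda>x e. l x *\<^sub>R e)"

definition contract_right ::
    "('b::real_vector \<Rightarrow> real) \<Rightarrow> ('a::real_vector, 'b) tensor \<Rightarrow> 'a" where
  "contract_right l = tensor_lift (\<lambda>x e. l e *\<^sub>R x)"

lemma
  fixes l :: "'a::real_vector \<Rightarrow> real" and e :: "'b::real_vector"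
  assumes "linear l"
  shows linear_contract_left: "linear (contract_left l :: ('a, 'b) tensor \<Rightarrow> 'b)"
    and contract_left_pure: "contract_left l (x \<otimes>\<^sub>t e) = l x *\<^sub>R e"
proof -
  have "bilinear (\<lambda>x (e::'b). l x *\<^sub>R e)"
    using assms unfolding bilinear_def
    by (auto intro!: linearI simp: linear_add linear_scale algebra_simps)
  then show "linear (contract_left l :: ('a, 'b) tensor \<Rightarrow> 'b)" "contract_left l (x \<otimes>\<^sub>t e) = l x *\<^sub>R e"
    unfolding contract_left_def by (simp_all add: linear_tensor_lift tensor_lift_pure)
qed

lemma
  fixes l :: "'b::real_vector \<Rightarrow> real" and x :: "'a::real_vector"
  assumes "linear l"
  shows linear_contract_right: "linear (contract_right l :: ('a, 'b) tensor \<Rightarrow> 'a)"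
    and contract_right_pure: "contract_right l (x \<otimes>\<^sub>t e) = l e *\<^sub>R x"
proof -
  have "bilinear (\<lambda>(x::'a) e. l e *\<^sub>R x)"
    using assms unfolding bilinear_def
    by (auto intro!: linearI simp: linear_add linear_scale algebra_simps)
  then show "linear (contract_right l :: ('a, 'b) tensor \<Rightarrow> 'a)" "contract_right l (x \<otimes>\<^sub>t e) = l e *\<^sub>R x"
    unfolding contract_right_def by (simp_all add: linear_tensor_lift tensor_lift_pure)
qed

lemma contract_right_free_action:
  assumes "linear l"
  shows "contract_right l (free_action y t) = y * contract_right l t"
proof -
  have "contract_right l \<circ> free_action y = (\<lambda>x. y * x) \<circ> contract_right l"
    by (rule tensor_linear_eqI)
      (simp_all add: assms linear_compose linear_free_action linear_contract_right
        linear_jordan_times free_action_pure contract_right_pure jordan_scaleR_right)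
  then show ?thesis by (simp add: fun_eq_iff)
qed

text \<open>Every tensor is recovered from its contractions with the coordinate functionals of a basis of
  the second factor; this is what reduces a statement about \<open>J \<otimes> E\<close> to one about \<open>J\<close>.\<close>

lemma tensor_basis_expansion:
  fixes t :: "('a::real_vector, 'b::real_vector) tensor"
  assumes "finite B" "independent B" "span B = UNIV"
  shows "t = (\<Sum>b\<in>B. contract_right (\<lambda>e. representation B e b) t \<otimes>\<^sub>t b)"
proof -
  have lin: "linear (\<lambda>e. representation B e b)" for b
    using assms by (intro linearI) (simp_all add: representation_add representation_scale)
  let ?S = "\<lambda>t :: ('a, 'b) tensor. \<Sum>b\<in>B. contract_right (\<lambda>e. representation B e b) t \<otimes>\<^sub>t b"
  have "(\<lambda>t. t) = ?S"
  proof (rule tensor_linear_eqI)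
    show "linear (\<lambda>t :: ('a, 'b) tensor. t)" by (rule linear_ident)
    show "linear ?S"
      by (intro linear_compose_sum ballI linearI)
        (simp_all add: linear_add[OF linear_contract_right[OF lin]]
          linear_scale[OF linear_contract_right[OF lin]] pure_tensor_simps)
    fix x :: 'a and e :: 'b
    have "x \<otimes>\<^sub>t e = x \<otimes>\<^sub>t (\<Sum>b\<in>B. representation B e b *\<^sub>R b)"
      using assms by (subst sum_representation_eq) simp_all
    also have "\<dots> = ?S (x \<otimes>\<^sub>t e)"
      by (simp add: linear_sum[OF linear_pure_right] contract_right_pure lin pure_tensor_simps)
    finally show "x \<otimes>\<^sub>t e = ?S (x \<otimes>\<^sub>t e)" .
  qed
  then show ?thesis by (rule fun_cong)
qed

lemma linear_functional_eq_1_exists: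
  fixes v :: "'a::real_vector"
  assumes "v \<noteq> 0"
  obtains l :: "'a \<Rightarrow> real" where "linear l" "l v = 1"
  using linear_independent_extend[of "{v}" "\<lambda>_. 1::real"] assms by auto

lemma pure_tensor_right_cancel:
  assumes "x \<otimes>\<^sub>t e = x \<otimes>\<^sub>t f" "x \<noteq> 0"
  shows "e = f"
proof -
  obtain l :: "'a \<Rightarrow> real" where "linear l" "l x = 1"
    using linear_functional_eq_1_exists[OF assms(2)] .
  then show ?thesis
    using arg_cong[OF assms(1), of "contract_left l"] by (simp add: contract_left_pure)
qed

lemma id_tensor_inject:
  fixes f g :: "'e::real_vector endo" and x :: "'j::jordan_algebra"
  assumes "x \<noteq> 0" "(id_tensor f :: ('j, 'e) tensor endo) = id_tensor g"
  shows "f = g"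
proof (rule endo_eqI)
  fix e
  show "endo_app f e = endo_app g e"
    using assms by (metis id_tensor_pure pure_tensor_right_cancel)
qed

section \<open>Endomorphisms of a free module\<close>

lemma jordan_one_right: "x * 1 = x" for x :: "'j::unital_jordan_algebra"
  by (metis jordan_commute jordan_one_left)

text \<open>Reversing an associator in a commutative algebra changes its sign, which gives the position
  \<open>[z, x, y]\<close>; in \<open>[x, z, y]\<close> both bracketings can be rewritten as \<open>(x y) z\<close>.\<close>

lemma associates_imp_center:
  fixes z :: "'j::jordan_algebra"
  assumes "\<And>x y. y * (x * z) = (y * x) * z"
  shows "z \<in> jordan_center"
proof -
  have "(x * y) * z = x * (y * z)" "(x * z) * y = x * (z * y)" "(z * x) * y = z * (x * y)" for x y
    using assms by (metis jordan_commute)+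
  then show ?thesis by (simp add: jordan_center_def associator_def)
qed

text \<open>The elements \<open>1 \<otimes> u\<close> are the only ones on which the operators \<open>x \<cdot>\<close> compose as the product
  of \<open>J\<close> does; their coefficients must be central.\<close>

lemma associating_tensor_eq_one_pure:
  fixes t :: "('j::unital_jordan_algebra, 'e::real_vector) tensor"
  assumes center: "(jordan_center :: 'j set) = range (\<lambda>r. r *\<^sub>R 1)"
    and fin: "finite_dim TYPE('e)"
    and assoc: "\<And>x y. free_action y (free_action x t) = free_action (y * x) t"
  obtains u where "t = 1 \<otimes>\<^sub>t u"
proof -
  obtain S :: "'e set" where S: "finite S" "span S = UNIV"
    using fin by (auto simp: finite_dim_def)
  obtain B where B: "B \<subseteq> S" "independent B" "S \<subseteq> span B"
    using maximal_independent_subset[of S] by auto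
  have finB: "finite B" and spanB: "span B = UNIV"
    using S B finite_subset span_mono[OF B(3)] by (auto simp: span_span)
  let ?z = "\<lambda>b. contract_right (\<lambda>e. representation B e b) t"
  have lin: "linear (\<lambda>e. representation B e b)" for b
    using B spanB by (intro linearI) (simp_all add: representation_add representation_scale)
  have "?z b \<in> jordan_center" for b
    using assoc by (intro associates_imp_center) (metis contract_right_free_action lin)
  then have "\<forall>b. \<exists>r. ?z b = r *\<^sub>R 1"
    by (auto simp: center)
  then obtain r where r: "\<And>b. ?z b = r b *\<^sub>R 1"
    by metis
  have "t = (\<Sum>b\<in>B. ?z b \<otimes>\<^sub>t b)"
    by (rule tensor_basis_expansion[OF finB B(2) spanB])
  also have "\<dots> = 1 \<otimes>\<^sub>t (\<Sum>b\<in>B. r b *\<^sub>R b)"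
    by (simp add: r linear_sum[OF linear_pure_right] pure_tensor_simps)
  finally show ?thesis by (rule that)
qed

text \<open>The map \<open>f\<close> is recovered from \<open>F\<close> by contracting \<open>F (1 \<otimes> e)\<close> with a functional that is
  \<open>1\<close> at the unit, which makes its linearity evident.\<close>

lemma action_commuting_endo:
  fixes F :: "('j::unital_jordan_algebra, 'e::real_vector) tensor endo"
  assumes one: "(1::'j) \<noteq> 0"
    and center: "(jordan_center :: 'j set) = range (\<lambda>r. r *\<^sub>R 1)"
    and fin: "finite_dim TYPE('e)"
    and comm: "\<And>x m. endo_app F (free_action x m) = free_action x (endo_app F m)"
  obtains f where "F = id_tensor f"
proof -
  obtain l :: "'j \<Rightarrow> real" where l: "linear l" "l 1 = 1"
    using linear_functional_eq_1_exists[OF one] .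
  define f where "f = Endo (\<lambda>e. contract_left l (endo_app F (1 \<otimes>\<^sub>t e)))"
  have "linear (\<lambda>e. contract_left l (endo_app F (1 \<otimes>\<^sub>t e)))"
    using linear_compose[OF linear_compose[OF linear_pure_right linear_endo_app]
        linear_contract_left[OF l(1)]]
    by (simp add: o_def)
  then have f: "endo_app f e = contract_left l (endo_app F (1 \<otimes>\<^sub>t e))" for e
    by (simp add: f_def Endo_inverse)
  have F1: "endo_app F (1 \<otimes>\<^sub>t e) = 1 \<otimes>\<^sub>t endo_app f e" for e
  proof -
    have "free_action y (free_action x (endo_app F (1 \<otimes>\<^sub>t e)))
        = free_action (y * x) (endo_app F (1 \<otimes>\<^sub>t e))" for x y
      by (simp add: comm[symmetric] free_action_pure jordan_one_right)
    then obtain u where "endo_app F (1 \<otimes>\<^sub>t e) = 1 \<otimes>\<^sub>t u"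
      using associating_tensor_eq_one_pure[OF center fin] by blast
    then show ?thesis by (simp add: f contract_left_pure l)
  qed
  have "F = id_tensor f"
  proof (rule endo_tensor_eqI)
    fix x :: 'j and e :: 'e
    have "endo_app F (x \<otimes>\<^sub>t e) = endo_app F (free_action x (1 \<otimes>\<^sub>t e))"
      by (simp add: free_action_pure jordan_one_right)
    also have "\<dots> = x \<otimes>\<^sub>t endo_app f e"
      unfolding comm F1 by (simp add: free_action_pure jordan_one_right)
    finally show "endo_app F (x \<otimes>\<^sub>t e) = endo_app (id_tensor f) (x \<otimes>\<^sub>t e)"
      by (simp add: id_tensor_pure)
  qed
  then show ?thesis by (rule that)
qed

section \<open>Connections on a free module and their curvature\<close>

lemma connection_of_leibniz:
  "endo_app (connection_of A X) (free_action x m)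
     = free_action (der_app X x) m + free_action x (endo_app (connection_of A X) m)"
proof -
  have "linear (\<lambda>m. free_action x (endo_app (connection_of A X) m))"
    using linear_compose[OF linear_endo_app linear_free_action] by (simp add: o_def)
  then have "endo_app (connection_of A X) \<circ> free_action x
      = (\<lambda>m. free_action (der_app X x) m + free_action x (endo_app (connection_of A X) m))"
    by (intro tensor_linear_eqI linear_compose_add linear_compose linear_free_action linear_endo_app)
      (simp_all add: free_action_pure connection_of_pure linear_add[OF linear_free_action]
        der_app_times pure_tensor_simps add.assoc)
  then show ?thesis by (simp add: fun_eq_iff)
qed

lemma free_action_scaled_one:
  fixes m :: "('j::unital_jordan_algebra, 'e::real_vector) tensor"
  shows "free_action (r *\<^sub>R 1) m = r *\<^sub>R m"
proof -
  have "free_action (r *\<^sub>R 1 :: 'j) = (\<lambda>m :: ('j, 'e) tensor. r *\<^sub>R m)"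
    by (rule tensor_linear_eqI)
      (simp_all add: linear_free_action linear_compose_scale_right linear_ident free_action_pure
        jordan_scaleR_left jordan_one_left pure_tensor_simps)
  then show ?thesis by simp
qed

text \<open>When the center consists of the real multiples of \<open>1\<close>, the linearity over the center
  that a connection must satisfy is linearity over the reals.\<close>

lemma connection_connection_of:
  fixes A :: "'j::unital_jordan_algebra der \<Rightarrow> 'e::real_vector endo"
  assumes center: "(jordan_center :: 'j set) = range (\<lambda>r. r *\<^sub>R 1)"
    and A: "linear A"
  shows "connection free_action (connection_of A)"
proof -
  have lin: "linear (connection_of A)"
    unfolding connection_of_def
    using linear_compose_add[OF linear_base_connection linear_compose[OF A linear_id_tensor]]
    by (simp add: o_def)
  have "r *\<^sub>R 1 \<in> (jordan_center :: 'j set)" for r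
    unfolding center by (rule rangeI)
  then have "center_scale (r *\<^sub>R 1) X = r *\<^sub>R X" for r and X :: "'j der"
    by (intro der_eqI) (simp add: der_app_center_scale jordan_scaleR_left jordan_one_left)
  then show ?thesis
    unfolding connection_def
    by (simp add: lin connection_of_leibniz center free_action_scaled_one linear_scale[OF lin])
qed

lemma connection_eq_connection_of:
  fixes D :: "'j::unital_jordan_algebra der \<Rightarrow> ('j, 'e::real_vector) tensor endo"
  assumes one: "(1::'j) \<noteq> 0"
    and center: "(jordan_center :: 'j set) = range (\<lambda>r. r *\<^sub>R 1)"
    and fin: "finite_dim TYPE('e)"
    and D: "connection free_action D"
  obtains A where "linear A" "D = connection_of A"
proof -
  have "\<exists>f. D X - base_connection X = id_tensor f" for X
  proof -
    (* The base connection is the connection of the zero map, so it obeys the same Leibniz rule. *)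
    have base: "connection_of (\<lambda>_. 0 :: 'e endo) X = base_connection X"
      by (simp add: connection_of_def linear_0[OF linear_id_tensor])
    have "endo_app (D X - base_connection X) (free_action x m)
        = free_action x (endo_app (D X - base_connection X) m)" for x m
      using D connection_of_leibniz[of "\<lambda>_. 0 :: 'e endo" X x m]
      by (simp add: connection_def base linear_diff[OF linear_free_action])
    then show ?thesis
      using action_commuting_endo[OF one center fin] by metis
  qed
  then obtain A where A: "\<And>X. D X - base_connection X = id_tensor (A X)"
    by metis
  have D_lin: "linear D"
    using D by (simp add: connection_def)
  (* Linearity passes from D and the base connection to A because f -> id (x) f is injective. *)
  have "linear A"
  proof (rule linearI)
    fix X Y and r :: real
    have "id_tensor (A (X + Y)) = (id_tensor (A X + A Y) :: ('j, 'e) tensor endo)"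
      by (simp add: linear_add[OF linear_id_tensor] A[symmetric] linear_add[OF D_lin]
          linear_add[OF linear_base_connection])
    then show "A (X + Y) = A X + A Y"
      by (rule id_tensor_inject[OF one])
    have "id_tensor (A (r *\<^sub>R X)) = (id_tensor (r *\<^sub>R A X) :: ('j, 'e) tensor endo)"
      by (simp add: linear_scale[OF linear_id_tensor] A[symmetric] linear_scale[OF D_lin]
          linear_scale[OF linear_base_connection] scaleR_diff_right)
    then show "A (r *\<^sub>R X) = r *\<^sub>R A X"
      by (rule id_tensor_inject[OF one])
  qed
  moreover have "D = connection_of A"
    by (simp add: fun_eq_iff connection_of_def A[symmetric])
  ultimately show ?thesis by (rule that)
qed

lemma connection_of_inject:
  fixes A A' :: "'j::jordan_algebra der \<Rightarrow> 'e::real_vector endo" and x :: 'j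
  assumes "x \<noteq> 0" "connection_of A = connection_of A'"
  shows "A = A'"
proof
  fix X
  have "(id_tensor (A X) :: ('j, 'e) tensor endo) = id_tensor (A' X)"
    using fun_cong[OF assms(2), of X] by (simp add: connection_of_def)
  then show "A X = A' X" by (rule id_tensor_inject[OF assms(1)])
qed

text \<open>Operators on different tensor factors commute, so only the commutator of the base connection
  with itself, which reproduces \<open>[X, Y]\<close>, and that of \<open>A\<close> with itself survive.\<close>

lemma curvature_connection_of:
  "curvature (connection_of A) X Y = id_tensor (curvature A X Y)"
  by (rule endo_tensor_eqI)
    (simp add: curvature_def connection_of_pure id_tensor_pure endo_app_simps pure_tensor_simps)

lemma flat_connection_of_iff:
  fixes A :: "'j::jordan_algebra der \<Rightarrow> 'e::real_vector endo" and x :: 'j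
  assumes "x \<noteq> 0"
  shows "flat (connection_of A) \<longleftrightarrow> flat A"
  unfolding flat_def curvature_connection_of
  by (metis id_tensor_inject[OF assms] linear_0[OF linear_id_tensor])

lemma lie_hom_iff_linear_flat: "lie_hom A \<longleftrightarrow> linear A \<and> flat A"
  by (auto simp: lie_hom_def flat_def curvature_def)

section \<open>Homomorphisms in terms of structure constants\<close>

lemma bilinear_lie_bracket: "bilinear lie_bracket"
  unfolding bilinear_def
  by (auto intro!: linearI simp: lie_add_left lie_add_right lie_scaleR_left lie_scaleR_right)

lemma lie_hom_iff_structure_constants:
  fixes A :: "'a::lie_algebra \<Rightarrow> 'b::lie_algebra" and X :: "'i \<Rightarrow> 'a"
  assumes span: "span (X ` I) = UNIV" and A: "linear A"
    and c: "\<And>\<mu> \<nu>. \<mu> \<in> I \<Longrightarrow> \<nu> \<in> I \<Longrightarrow>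
      lie_bracket (X \<mu>) (X \<nu>) = (\<Sum>\<tau>\<in>I. c \<mu> \<nu> \<tau> *\<^sub>R X \<tau>)"
  shows "lie_hom A \<longleftrightarrow>
    (\<forall>\<mu>\<in>I. \<forall>\<nu>\<in>I. lie_bracket (A (X \<mu>)) (A (X \<nu>)) = (\<Sum>\<tau>\<in>I. c \<mu> \<nu> \<tau> *\<^sub>R A (X \<tau>)))"
    (is "_ \<longleftrightarrow> ?R")
proof -
  have Ac: "A (lie_bracket (X \<mu>) (X \<nu>)) = (\<Sum>\<tau>\<in>I. c \<mu> \<nu> \<tau> *\<^sub>R A (X \<tau>))"
    if "\<mu> \<in> I" "\<nu> \<in> I" for \<mu> \<nu>
    by (simp add: c[OF that] linear_sum[OF A] linear_scale[OF A])
  have "lie_hom A" if R: ?R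
  proof -
    have "bilinear (\<lambda>U V. A (lie_bracket U V))" "bilinear (\<lambda>U V. lie_bracket (A U) (A V))"
      unfolding bilinear_def
      by (auto intro!: linearI simp: linear_add[OF A] linear_scale[OF A]
          lie_add_left lie_add_right lie_scaleR_left lie_scaleR_right)
    then have "A (lie_bracket U V) = lie_bracket (A U) (A V)" for U V
      by (rule bilinear_eq[of _ _ UNIV "X ` I" UNIV "X ` I"]) (use span Ac R in auto)
    with A show ?thesis by (simp add: lie_hom_def)
  qed
  moreover have ?R if "lie_hom A"
    using that Ac by (simp add: lie_hom_def)
  ultimately show ?thesis by blast
qed

section \<open>Flat connections and Lie algebra homomorphisms\<close>

theorem proposition6p7:
  assumes "simple_jordan TYPE('j::unital_jordan_algebra)"
    and "finite_dim TYPE('j)"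
    and "(jordan_center :: 'j set) = range (\<lambda>r. r *\<^sub>R 1)"
    and "finite_dim TYPE('e::real_vector)"
  shows "bij_betw connection_of
           {A :: 'j der \<Rightarrow> 'e endo. lie_hom A}
           {D :: 'j der \<Rightarrow> ('j, 'e) tensor endo. connection free_action D \<and> flat D}
    \<and> (\<forall>(A :: 'j der \<Rightarrow> 'e endo) X x e.
           endo_app (connection_of A X) (x \<otimes>\<^sub>t e)
             = der_app X x \<otimes>\<^sub>t e + x \<otimes>\<^sub>t endo_app (A X) e)
    \<and> (\<forall>(I :: 'i set) (X :: 'i \<Rightarrow> 'j der) (c :: 'i \<Rightarrow> 'i \<Rightarrow> 'i \<Rightarrow> real) (A :: 'j der \<Rightarrow> 'e endo).
           finite I \<and> inj_on X I \<and> independent (X ` I) \<and> span (X ` I) = UNIV \<and>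
           (\<forall>\<mu>\<in>I. \<forall>\<nu>\<in>I. lie_bracket (X \<mu>) (X \<nu>) = (\<Sum>\<tau>\<in>I. c \<mu> \<nu> \<tau> *\<^sub>R X \<tau>)) \<and>
           linear A \<longrightarrow>
           (lie_hom A \<longleftrightarrow>
             (\<forall>\<mu>\<in>I. \<forall>\<nu>\<in>I. lie_bracket (A (X \<mu>)) (A (X \<nu>)) = (\<Sum>\<tau>\<in>I. c \<mu> \<nu> \<tau> *\<^sub>R A (X \<tau>)))))"
proof -
  obtain x :: 'j where "x \<noteq> 0"
    using assms(1) by (auto simp: simple_jordan_def)
  then have one: "(1::'j) \<noteq> 0"
    by (metis jordan_one_left bilinear_lzero[OF bilinear_jordan_times])
  have "bij_betw connection_of {A :: 'j der \<Rightarrow> 'e endo. lie_hom A}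
      {D :: 'j der \<Rightarrow> ('j, 'e) tensor endo. connection free_action D \<and> flat D}"
    unfolding bij_betw_def
  proof (intro conjI inj_onI set_eqI iffI)
    fix A A' :: "'j der \<Rightarrow> 'e endo"
    assume "connection_of A = connection_of A'"
    then show "A = A'" by (rule connection_of_inject[OF one])
  next
    fix D :: "'j der \<Rightarrow> ('j, 'e) tensor endo"
    assume "D \<in> connection_of ` {A. lie_hom A}"
    then show "D \<in> {D. connection free_action D \<and> flat D}"
      by (auto simp: lie_hom_iff_linear_flat connection_connection_of[OF assms(3)]
          flat_connection_of_iff[OF one])
  next
    fix D :: "'j der \<Rightarrow> ('j, 'e) tensor endo"
    assume D: "D \<in> {D. connection free_action D \<and> flat D}"
    then obtain A where A: "linear A" "D = connection_of A"
      using connection_eq_connection_of[OF one assms(3,4)] by blast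
    with D have "lie_hom A"
      by (simp add: lie_hom_iff_linear_flat flat_connection_of_iff[OF one])
    with A(2) show "D \<in> connection_of ` {A. lie_hom A}" by blast
  qed
  moreover have "lie_hom A \<longleftrightarrow>
      (\<forall>\<mu>\<in>I. \<forall>\<nu>\<in>I. lie_bracket (A (X \<mu>)) (A (X \<nu>)) = (\<Sum>\<tau>\<in>I. c \<mu> \<nu> \<tau> *\<^sub>R A (X \<tau>)))"
    if "span (X ` I) = UNIV" "linear A"
      "\<forall>\<mu>\<in>I. \<forall>\<nu>\<in>I. lie_bracket (X \<mu>) (X \<nu>) = (\<Sum>\<tau>\<in>I. c \<mu> \<nu> \<tau> *\<^sub>R X \<tau>)"
    for I :: "'i set" and X :: "'i \<Rightarrow> 'j der" and c and A :: "'j der \<Rightarrow> 'e endo"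
    using that by (intro lie_hom_iff_structure_constants) auto
  ultimately show ?thesis
    by (auto simp only: connection_of_pure)
qed

end
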